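(* Let $\varphi\in\Phi$ and $(\tau,z,w(\cdot))\in\mathbb G$, $\tau<\vartheta$. If $\varphi$ is ci-differentiable at $(\tau,z,w(\cdot))$, then $$D^-\varphi(\tau,z,w(\cdot))=\{(p_0,p)\in\mathbb R\times\mathbb R^n: p_0\le\partial^{ci}_{\tau,w}\varphi(\tau,z,w(\cdot)),\ p=\nabla_z\varphi(\tau,z,w(\cdot))\},$$ $$D^+\varphi(\tau,z,w(\cdot))=\{(q_0,q)\in\mathbb R\times\mathbb R^n: q_0\ge\partial^{ci}_{\tau,w}\varphi(\tau,z,w(\cdot)),\ q=\nabla_z\varphi(\tau,z,w(\cdot))\}.$$
   Context: **Spaces.** $\mathbb R^n$ has inner product $\langle\cdot,\cdot\rangle$ and norm $\|\cdot\|$. A function $x(\cdot)$ from $[a,b)$ (or $[a,b]$) to $\mathbb R^n$ is piecewise continuous if there are $a=\xi_1<\xi_2<\dots<\xi_k=b$ such that for each $i\in\{1,\dots,k-1\}$ it is continuous on $[\xi_i,\xi_{i+1})$ and has a finite left limit at $\xi_{i+1}$. $\mathrm{PC}([a,b),\mathbb R^n)$ (or $\mathrm{PC}([a,b],\mathbb R^n)$) is the linear space of such functions. Fix $t_0<\vartheta$, $h>0$; $\mathrm{PC}=\mathrm{PC}([-h,0),\mathbb R^n)$, $\mathbb G=[t_0,\vartheta]\times\mathbb R^n\times\mathrm{PC}$. For $w(\cdot)\in\mathrm{PC}$: $\|w(\cdot)\|_1=\int_{-h}^0\|w(\xi)\|d\xi$, $\|w(\cdot)\|_\infty=\sup_{\xi\in[-h,0)}\|w(\xi)\|$.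 For $\alpha\ge0$, $P(\alpha)=\{(x,r(\cdot))\in\mathbb R^n\times\mathrm{PC}:\|x\|\le\alpha,\ \|r(\cdot)\|_\infty\le\alpha\}$. For a function $x(\cdot)$ defined on $[t-h,t)$, $x_t(\cdot)\in\mathrm{PC}$ denotes $x_t(\xi)=x(t+\xi)$, $\xi\in[-h,0)$. **Class $\Phi$.** $\Phi$ is the set of functionals $\varphi:\mathbb G\to\mathbb R$ that are continuous in $\tau$ (for each fixed $(z,w(\cdot))$) and such that for every $\alpha>0$ there is $\lambda_\varphi>0$ with $|\varphi(\tau,z,w(\cdot))-\varphi(\tau,z',w'(\cdot))|\le\lambda_\varphi(\|z-z'\|+\|w(\cdot)-w'(\cdot)\|_1)$ for all $\tau\in[t_0,\vartheta]$, $(z,w(\cdot)),(z',w'(\cdot))\in P(\alpha)$. **Coinvariant differentiability.** Let $\Lambda(\tau,z,w(\cdot))$ be the set of $x(\cdot)\in\mathrm{PC}([\tau-h,\vartheta],\mathbb R^n)$ with $x(\tau)=z$, $x(t)=w(t-\tau)$ for $t\in[\tau-h,\tau)$, and $x(\cdot)$ Lipschitz continuous on $[\tau,\vartheta]$. A functional $\varphi:\mathbb G\to\mathbb R$ is ci-differentiable at $(\tau,z,w(\cdot))\in\mathbb G$, $\tau<\vartheta$, if there exist $\partial^{ci}_{\tau,w}\varphi(\tau,z,w(\cdot))\in\mathbb R$ and $\nabla_z\varphi(\tau,z,w(\cdot))\in\mathbb R^n$ such that for every $t\in[\tau,\vartheta]$, $x\in\mathbb R^n$, $y(\cdot)\in\Lambda(\tau,z,w(\cdot))$,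 $$\varphi(t,x,y_t(\cdot))-\varphi(\tau,z,w(\cdot))=(t-\tau)\,\partial^{ci}_{\tau,w}\varphi(\tau,z,w(\cdot))+\langle x-z,\nabla_z\varphi(\tau,z,w(\cdot))\rangle+o(|t-\tau|+\|x-z\|),$$ where $o(\cdot)$ depends on $\{\tau,z,y(\cdot)\}$ and $o(\delta)/\delta\to0$ as $\delta\to+0$. **Sub- and superdifferentials.** For $(\tau,z,w(\cdot))\in\mathbb G$, $\tau<\vartheta$, let $\kappa(t)=w(t-\tau)$ for $t\in[\tau-h,\tau)$, $\kappa(t)=z$ for $t\in[\tau,\vartheta]$, and $O^+_\delta(\tau,z)=\{(t,x):t\in[\tau,\min\{\tau+\delta,\vartheta\}],\ x\in\mathbb R^n,\ \|x-z\|\le\delta\}$. $D^-\varphi(\tau,z,w(\cdot))$ is the set of $(p_0,p)\in\mathbb R\times\mathbb R^n$ with $$\lim_{\delta\to0}\inf_{(t,x)\in O^+_\delta(\tau,z)}\frac{\varphi(t,x,\kappa_t(\cdot))-\varphi(\tau,z,w(\cdot))-(t-\tau)p_0-\langle x-z,p\rangle}{|t-\tau|+\|x-z\|}\ge0,$$ and $D^+\varphi(\tau,z,w(\cdot))$ is the set of $(q_0,q)\in\mathbb R\times\mathbb R^n$ with $$\lim_{\delta\to0}\sup_{(t,x)\in O^+_\delta(\tau,z)}\frac{\varphi(t,x,\kappa_t(\cdot))-\varphi(\tau,z,w(\cdot))-(t-\tau)q_0-\langle x-z,q\rangle}{|t-\tau|+\|x-z\|}\le0,$$ the infimum and supremum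 being over $(t,x)\ne(\tau,z)$. *)

theory Defs
  imports "HOL-Analysis.Analysis" "HOL-Library.Landau_Symbols"
begin

text \<open>
  The numbers \<open>t0\<close>, \<open>\<theta>\<close> and \<open>h\<close> are fixed data; they are explicit parameters here.
  A function with domain \<open>S\<close> is an element of \<^term>\<open>extensional S\<close>, so that it carries no
  information outside \<open>S\<close>. A functional on \<open>G\<close> is a curried total function; only its
  values on \<open>G\<close> are ever used.
\<close>

text \<open>For the closed interval \<open>[a, b]\<close> the condition is the same as for \<open>[a, b)\<close>: the value
  at \<open>b\<close> is unconstrained.\<close>

definition piecewise_continuous :: "real \<Rightarrow> real \<Rightarrow> (real \<Rightarrow> 'a::real_normed_vector) \<Rightarrow> bool" where
  "piecewise_continuous a b x \<longleftrightarrow>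
     (\<exists>(k::nat) (\<xi>::nat \<Rightarrow> real). \<xi> 0 = a \<and> \<xi> k = b \<and>
        (\<forall>i<k. \<xi> i < \<xi> (Suc i) \<and>
               continuous_on {\<xi> i..<\<xi> (Suc i)} x \<and>
               (\<exists>l. (x \<longlongrightarrow> l) (at_left (\<xi> (Suc i))))))"

definition PC_Ico :: "real \<Rightarrow> real \<Rightarrow> (real \<Rightarrow> 'a::real_normed_vector) set" where
  "PC_Ico a b = {x \<in> extensional {a..<b}. piecewise_continuous a b x}"

definition PC_Icc :: "real \<Rightarrow> real \<Rightarrow> (real \<Rightarrow> 'a::real_normed_vector) set" where
  "PC_Icc a b = {x \<in> extensional {a..b}. piecewise_continuous a b x}"

definition PC :: "real \<Rightarrow> (real \<Rightarrow> 'a::real_normed_vector) set" where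
  "PC h = PC_Ico (- h) 0"

definition GG :: "real \<Rightarrow> real \<Rightarrow> real \<Rightarrow> (real \<times> 'a::real_normed_vector \<times> (real \<Rightarrow> 'a)) set" where
  "GG t0 \<theta> h = {t0..\<theta>} \<times> UNIV \<times> PC h"

definition norm_L1 :: "real \<Rightarrow> (real \<Rightarrow> 'a::real_normed_vector) \<Rightarrow> real" where
  "norm_L1 h w = integral {- h..<0} (\<lambda>\<xi>. norm (w \<xi>))"

definition norm_sup :: "real \<Rightarrow> (real \<Rightarrow> 'a::real_normed_vector) \<Rightarrow> real" where
  "norm_sup h w = (SUP \<xi>\<in>{- h..<0}. norm (w \<xi>))"

definition PP :: "real \<Rightarrow> real \<Rightarrow> ('a::real_normed_vector \<times> (real \<Rightarrow> 'a)) set" where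
  "PP h \<alpha> = {(x, r). r \<in> PC h \<and> norm x \<le> \<alpha> \<and> norm_sup h r \<le> \<alpha>}"

text \<open>The segment \<open>x\<^sub>t\<close> of \<open>x\<close>, moved to the domain \<open>[-h, 0)\<close>.\<close>

definition segment :: "real \<Rightarrow> (real \<Rightarrow> 'a) \<Rightarrow> real \<Rightarrow> (real \<Rightarrow> 'a)" where
  "segment h x t = (\<lambda>\<xi>\<in>{- h..<0}. x (t + \<xi>))"

definition Phi :: "real \<Rightarrow> real \<Rightarrow> real \<Rightarrow>
    (real \<Rightarrow> 'a::real_normed_vector \<Rightarrow> (real \<Rightarrow> 'a) \<Rightarrow> real) set" where
  "Phi t0 \<theta> h = {\<phi>.
     (\<forall>z. \<forall>w\<in>PC h. continuous_on {t0..\<theta>} (\<lambda>\<tau>. \<phi> \<tau> z w)) \<and>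
     (\<forall>\<alpha>>0. \<exists>K>0. \<forall>\<tau>\<in>{t0..\<theta>}. \<forall>(z, w)\<in>PP h \<alpha>. \<forall>(z', w')\<in>PP h \<alpha>.
        \<bar>\<phi> \<tau> z w - \<phi> \<tau> z' w'\<bar> \<le> K * (norm (z - z') + norm_L1 h (\<lambda>\<xi>. w \<xi> - w' \<xi>)))}"

definition Lambda :: "real \<Rightarrow> real \<Rightarrow> real \<Rightarrow> 'a::real_normed_vector \<Rightarrow> (real \<Rightarrow> 'a) \<Rightarrow>
    (real \<Rightarrow> 'a) set" where
  "Lambda \<theta> h \<tau> z w = {x \<in> PC_Icc (\<tau> - h) \<theta>.
     x \<tau> = z \<and> (\<forall>t\<in>{\<tau> - h..<\<tau>}. x t = w (t - \<tau>)) \<and> (\<exists>L. L-lipschitz_on {\<tau>..\<theta>} x)}"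

text \<open>The remainder term, whose \<open>o\<close> may depend on \<open>y\<close>, is small uniformly in
  \<open>(t, x) \<in> [\<tau>, \<theta>] \<times> \<real>\<^sup>n\<close> as \<open>(t, x)\<close> tends to \<open>(\<tau>, z)\<close>.\<close>

definition has_ci_derivative :: "real \<Rightarrow> real \<Rightarrow>
    (real \<Rightarrow> 'a::real_inner \<Rightarrow> (real \<Rightarrow> 'a) \<Rightarrow> real) \<Rightarrow>
    real \<Rightarrow> 'a \<Rightarrow> (real \<Rightarrow> 'a) \<Rightarrow> real \<Rightarrow> 'a \<Rightarrow> bool" where
  "has_ci_derivative \<theta> h \<phi> \<tau> z w d g \<longleftrightarrow>
     (\<forall>y\<in>Lambda \<theta> h \<tau> z w.
        (\<lambda>(t, x). \<phi> t x (segment h y t) - \<phi> \<tau> z w - ((t - \<tau>) * d + inner (x - z) g))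
          \<in> o[at (\<tau>, z) within {\<tau>..\<theta>} \<times> UNIV](\<lambda>(t, x). \<bar>t - \<tau>\<bar> + norm (x - z)))"

definition ci_differentiable :: "real \<Rightarrow> real \<Rightarrow>
    (real \<Rightarrow> 'a::real_inner \<Rightarrow> (real \<Rightarrow> 'a) \<Rightarrow> real) \<Rightarrow>
    real \<Rightarrow> 'a \<Rightarrow> (real \<Rightarrow> 'a) \<Rightarrow> bool" where
  "ci_differentiable \<theta> h \<phi> \<tau> z w \<longleftrightarrow> (\<exists>d g. has_ci_derivative \<theta> h \<phi> \<tau> z w d g)"

definition ci_deriv :: "real \<Rightarrow> real \<Rightarrow>
    (real \<Rightarrow> 'a::real_inner \<Rightarrow> (real \<Rightarrow> 'a) \<Rightarrow> real) \<Rightarrow>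
    real \<Rightarrow> 'a \<Rightarrow> (real \<Rightarrow> 'a) \<Rightarrow> real" where
  "ci_deriv \<theta> h \<phi> \<tau> z w = (THE d. \<exists>g. has_ci_derivative \<theta> h \<phi> \<tau> z w d g)"

definition ci_grad :: "real \<Rightarrow> real \<Rightarrow>
    (real \<Rightarrow> 'a::real_inner \<Rightarrow> (real \<Rightarrow> 'a) \<Rightarrow> real) \<Rightarrow>
    real \<Rightarrow> 'a \<Rightarrow> (real \<Rightarrow> 'a) \<Rightarrow> 'a" where
  "ci_grad \<theta> h \<phi> \<tau> z w = (THE g. \<exists>d. has_ci_derivative \<theta> h \<phi> \<tau> z w d g)"

definition kappa :: "real \<Rightarrow> real \<Rightarrow> real \<Rightarrow> 'a \<Rightarrow> (real \<Rightarrow> 'a) \<Rightarrow> (real \<Rightarrow> 'a)" where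
  "kappa \<theta> h \<tau> z w = (\<lambda>t\<in>{\<tau> - h..\<theta>}. if t < \<tau> then w (t - \<tau>) else z)"

definition O_plus :: "real \<Rightarrow> real \<Rightarrow> 'a::real_normed_vector \<Rightarrow> real \<Rightarrow> (real \<times> 'a) set" where
  "O_plus \<theta> \<tau> z \<delta> = {(t, x). t \<in> {\<tau>..min (\<tau> + \<delta>) \<theta>} \<and> norm (x - z) \<le> \<delta>}"

definition diff_quotient :: "real \<Rightarrow> real \<Rightarrow>
    (real \<Rightarrow> 'a::real_inner \<Rightarrow> (real \<Rightarrow> 'a) \<Rightarrow> real) \<Rightarrow>
    real \<Rightarrow> 'a \<Rightarrow> (real \<Rightarrow> 'a) \<Rightarrow> real \<Rightarrow> 'a \<Rightarrow> real \<Rightarrow> 'a \<Rightarrow> real" where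
  "diff_quotient \<theta> h \<phi> \<tau> z w p0 p t x =
     (\<phi> t x (segment h (kappa \<theta> h \<tau> z w) t) - \<phi> \<tau> z w - (t - \<tau>) * p0 - inner (x - z) p)
       / (\<bar>t - \<tau>\<bar> + norm (x - z))"

text \<open>The infimum and supremum, and hence their limits, may be infinite for every \<open>\<delta>\<close>, so they
  are taken in the extended reals.\<close>

definition D_minus :: "real \<Rightarrow> real \<Rightarrow>
    (real \<Rightarrow> 'a::real_inner \<Rightarrow> (real \<Rightarrow> 'a) \<Rightarrow> real) \<Rightarrow>
    real \<Rightarrow> 'a \<Rightarrow> (real \<Rightarrow> 'a) \<Rightarrow> (real \<times> 'a) set" where
  "D_minus \<theta> h \<phi> \<tau> z w = {(p0, p).
     \<exists>l::ereal. ((\<lambda>\<delta>. INF (t, x)\<in>O_plus \<theta> \<tau> z \<delta> - {(\<tau>, z)}.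
                    ereal (diff_quotient \<theta> h \<phi> \<tau> z w p0 p t x)) \<longlongrightarrow> l) (at_right 0) \<and> l \<ge> 0}"

definition D_plus :: "real \<Rightarrow> real \<Rightarrow>
    (real \<Rightarrow> 'a::real_inner \<Rightarrow> (real \<Rightarrow> 'a) \<Rightarrow> real) \<Rightarrow>
    real \<Rightarrow> 'a \<Rightarrow> (real \<Rightarrow> 'a) \<Rightarrow> (real \<times> 'a) set" where
  "D_plus \<theta> h \<phi> \<tau> z w = {(q0, q).
     \<exists>l::ereal. ((\<lambda>\<delta>. SUP (t, x)\<in>O_plus \<theta> \<tau> z \<delta> - {(\<tau>, z)}.
                    ereal (diff_quotient \<theta> h \<phi> \<tau> z w q0 q t x)) \<longlongrightarrow> l) (at_right 0) \<and> l \<le> 0}"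

end

theory Submission imports Defs
begin

text \<open>The path \<open>\<kappa>\<close> belongs to \<open>\<Lambda>(\<tau>, z, w)\<close>, so the expansion of \<open>\<phi>\<close> holds along it. Hence the
  numerator of the difference quotient is \<open>(t - \<tau>)(d - p\<^sub>0) + \<langle>x - z, g - p\<rangle>\<close> up to a small remainder.
  Since \<open>t - \<tau> \<ge> 0\<close> while \<open>x - z\<close> is arbitrary, the lower limit is nonnegative iff \<open>p\<^sub>0 \<le> d\<close> and
  \<open>p = g\<close>. The formula for \<open>D\<^sup>+\<close> is the one for \<open>D\<^sup>-\<close> applied to \<open>-\<phi>\<close>; uniqueness of \<open>(d, g)\<close>
  follows because \<open>D\<^sup>-\<close> determines the pair.\<close>

section \<open>Sub- and superdifferentials in epsilon-delta form\<close>

text \<open>As the sets shrink with \<delta>, the infimum can only grow, so its limit at 0 from the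
  right always exists in the extended reals. Only the sign of that limit carries
  information.\<close>

lemma tendsto_INF_at_right_nonneg_iff:
  fixes f :: "'v \<Rightarrow> real" and S :: "real \<Rightarrow> 'v set"
  assumes mono: "\<And>a b. a \<le> b \<Longrightarrow> S a \<subseteq> S b"
  shows "(\<exists>l::ereal. ((\<lambda>\<delta>. INF v\<in>S \<delta>. ereal (f v)) \<longlongrightarrow> l) (at_right 0) \<and> l \<ge> 0)
    \<longleftrightarrow> (\<forall>e>0. \<exists>\<delta>>0. \<forall>v\<in>S \<delta>. f v \<ge> - e)" (is "?L \<longleftrightarrow> ?R")
proof
  assume ?L
  then obtain l where l: "((\<lambda>\<delta>. INF v\<in>S \<delta>. ereal (f v)) \<longlongrightarrow> l) (at_right 0)" "l \<ge> 0"
    by blast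
  show ?R
  proof (intro allI impI)
    fix e :: real assume "e > 0"
    then have "ereal (- e) < 0" by simp
    then have "ereal (- e) < l" using l(2) by (rule less_le_trans)
    then have "\<forall>\<^sub>F \<delta> in at_right 0. ereal (- e) < (INF v\<in>S \<delta>. ereal (f v))"
      using l(1) by (rule order_tendstoD(1)[rotated])
    then obtain b where b: "b > 0" "\<And>\<delta>. 0 < \<delta> \<Longrightarrow> \<delta> < b \<Longrightarrow> ereal (- e) < (INF v\<in>S \<delta>. ereal (f v))"
      unfolding eventually_at_right_field by auto
    have "f v \<ge> - e" if "v \<in> S (b / 2)" for v
    proof -
      have "ereal (- e) < (INF v\<in>S (b / 2). ereal (f v))" using b by simp
      also have "\<dots> \<le> ereal (f v)" using that by (rule INF_lower)
      finally show ?thesis by simp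
    qed
    then show "\<exists>\<delta>>0. \<forall>v\<in>S \<delta>. f v \<ge> - e" using b(1) half_gt_zero by blast
  qed
next
  assume R: ?R
  define F where "F \<delta> = (INF v\<in>S \<delta>. ereal (f v))" for \<delta>
  \<comment> \<open>By monotonicity the limit must be the supremum over all positive
    \<delta>.\<close>
  define l where "l = (SUP \<delta>\<in>{0<..}. F \<delta>)"
  have anti: "F b \<le> F a" if "a \<le> b" for a b
    unfolding F_def using mono[OF that] by (intro INF_superset_mono) auto
  have "(F \<longlongrightarrow> l) (at_right 0)"
  proof (rule order_tendstoI)
    fix a assume "a < l"
    then obtain b where "b > 0" "a < F b" unfolding l_def less_SUP_iff by auto
    then show "\<forall>\<^sub>F x in at_right 0. a < F x"
      unfolding eventually_at_right_field using anti by (meson less_imp_le less_le_trans)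
  next
    fix a assume "l < a"
    have "F x \<le> l" if "x > 0" for x unfolding l_def using that by (intro SUP_upper) auto
    then show "\<forall>\<^sub>F x in at_right 0. F x < a"
      unfolding eventually_at_right_field using \<open>l < a\<close> by (meson le_less_trans zero_less_one)
  qed
  moreover have "l \<ge> 0"
  proof (rule ccontr)
    assume "\<not> l \<ge> 0"
    then have "l < 0" by simp
    \<comment> \<open>A real \<open>r\<close> strictly between \<open>l\<close> and 0 exists even if
      \<open>l\<close> is minus infinity; \<open>- r\<close> then serves as the tolerance in
      \<open>R\<close>.\<close>
    then obtain r where r: "l < ereal r" "ereal r < 0" using ereal_dense2 by blast
    then have "- r > 0" by simp
    then obtain b where b: "b > 0" "\<forall>v\<in>S b. f v \<ge> - (- r)" using R by blast
    then have "ereal r \<le> F b" unfolding F_def by (intro INF_greatest) auto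
    also have "\<dots> \<le> l" unfolding l_def using b(1) by (intro SUP_upper) auto
    finally show False using r(1) by simp
  qed
  ultimately show ?L unfolding F_def by blast
qed

lemma mem_D_minus_iff:
  "(p0, p) \<in> D_minus \<theta> h \<phi> \<tau> z w \<longleftrightarrow>
     (\<forall>e>0. \<exists>\<delta>>0. \<forall>(t, x)\<in>O_plus \<theta> \<tau> z \<delta> - {(\<tau>, z)}. diff_quotient \<theta> h \<phi> \<tau> z w p0 p t x \<ge> - e)"
proof -
  have "O_plus \<theta> \<tau> z a - {(\<tau>, z)} \<subseteq> O_plus \<theta> \<tau> z b - {(\<tau>, z)}" if "a \<le> b" for a b
    using that unfolding O_plus_def by auto
  from tendsto_INF_at_right_nonneg_iff[where S="\<lambda>\<delta>. O_plus \<theta> \<tau> z \<delta> - {(\<tau>, z)}"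
      and f="\<lambda>(t, x). diff_quotient \<theta> h \<phi> \<tau> z w p0 p t x", OF this]
  show ?thesis unfolding D_minus_def by (simp add: case_prod_unfold)
qed

text \<open>Changing the sign of both the functional and the pair changes the sign of the quotient,
  so the supremum becomes minus an infimum. Negation is continuous on the extended reals and carries
  a limit \<open>l\<close> to \<open>- l\<close>.\<close>

lemma mem_D_plus_iff:
  "(q0, q) \<in> D_plus \<theta> h \<phi> \<tau> z w \<longleftrightarrow>
     (- q0, - q) \<in> D_minus \<theta> h (\<lambda>t x y. - \<phi> t x y) \<tau> z w"
proof -
  let ?S = "\<lambda>\<delta>. O_plus \<theta> \<tau> z \<delta> - {(\<tau>, z)}"
  let ?Q = "\<lambda>v. diff_quotient \<theta> h \<phi> \<tau> z w q0 q (fst v) (snd v)"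
  let ?N = "\<lambda>v. diff_quotient \<theta> h (\<lambda>t x y. - \<phi> t x y) \<tau> z w (- q0) (- q) (fst v) (snd v)"
  have "?N v = - ?Q v" for v
    unfolding diff_quotient_def minus_divide_left by (simp add: algebra_simps)
  then have "(INF v\<in>?S \<delta>. ereal (?N v)) = - (SUP v\<in>?S \<delta>. ereal (?Q v))" for \<delta>
    by (simp add: ereal_INF_uminus_eq flip: uminus_ereal.simps)
  moreover have "(\<exists>l. ((\<lambda>\<delta>. SUP v\<in>?S \<delta>. ereal (?Q v)) \<longlongrightarrow> l) (at_right 0) \<and> l \<le> 0) \<longleftrightarrow>
      (\<exists>l. ((\<lambda>\<delta>. - (SUP v\<in>?S \<delta>. ereal (?Q v))) \<longlongrightarrow> l) (at_right 0) \<and> l \<ge> 0)"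
  proof safe
    fix l assume "((\<lambda>\<delta>. SUP v\<in>?S \<delta>. ereal (?Q v)) \<longlongrightarrow> l) (at_right 0)" "l \<le> 0"
    then show "\<exists>l. ((\<lambda>\<delta>. - (SUP v\<in>?S \<delta>. ereal (?Q v))) \<longlongrightarrow> l) (at_right 0) \<and> l \<ge> 0"
      by (intro exI[of _ "- l"]) (auto intro: tendsto_uminus_ereal)
  next
    fix l assume "((\<lambda>\<delta>. - (SUP v\<in>?S \<delta>. ereal (?Q v))) \<longlongrightarrow> l) (at_right 0)" "l \<ge> 0"
    then show "\<exists>l. ((\<lambda>\<delta>. SUP v\<in>?S \<delta>. ereal (?Q v)) \<longlongrightarrow> l) (at_right 0) \<and> l \<le> 0"
      by (intro exI[of _ "- l"]) (auto dest: tendsto_uminus_ereal)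
  qed
  ultimately show ?thesis
    unfolding D_plus_def D_minus_def by (simp add: case_prod_unfold)
qed

lemma has_ci_derivative_uminus:
  assumes "has_ci_derivative \<theta> h \<phi> \<tau> z w d g"
  shows "has_ci_derivative \<theta> h (\<lambda>t x y. - \<phi> t x y) \<tau> z w (- d) (- g)"
  unfolding has_ci_derivative_def
proof
  fix y assume "y \<in> Lambda \<theta> h \<tau> z w"
  with assms have "(\<lambda>(t, x). \<phi> t x (segment h y t) - \<phi> \<tau> z w - ((t - \<tau>) * d + inner (x - z) g))
      \<in> o[at (\<tau>, z) within {\<tau>..\<theta>} \<times> UNIV](\<lambda>(t, x). \<bar>t - \<tau>\<bar> + norm (x - z))"
    unfolding has_ci_derivative_def by blast
  then have "(\<lambda>v. - (case v of (t, x) \<Rightarrow> \<phi> t x (segment h y t) - \<phi> \<tau> z w - ((t - \<tau>) * d + inner (x - z) g)))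
      \<in> o[at (\<tau>, z) within {\<tau>..\<theta>} \<times> UNIV](\<lambda>(t, x). \<bar>t - \<tau>\<bar> + norm (x - z))"
    by simp
  then show "(\<lambda>(t, x). - \<phi> t x (segment h y t) - - \<phi> \<tau> z w - ((t - \<tau>) * - d + inner (x - z) (- g)))
      \<in> o[at (\<tau>, z) within {\<tau>..\<theta>} \<times> UNIV](\<lambda>(t, x). \<bar>t - \<tau>\<bar> + norm (x - z))"
    by (simp add: case_prod_unfold algebra_simps)
qed

section \<open>The path \<open>kappa\<close> as a member of \<open>Lambda\<close>\<close>

lemma piecewise_continuous_kappa:
  assumes w: "piecewise_continuous (- h) 0 w" and "\<tau> < \<theta>"
  shows "piecewise_continuous (\<tau> - h) \<theta> (kappa \<theta> h \<tau> z w)"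
proof -
  obtain k \<xi> where \<xi>: "\<xi> (0::nat) = - h" "\<xi> k = 0"
    and pc: "\<And>i. i < k \<Longrightarrow> \<xi> i < \<xi> (Suc i) \<and> continuous_on {\<xi> i..<\<xi> (Suc i)} w \<and>
      (\<exists>l. (w \<longlongrightarrow> l) (at_left (\<xi> (Suc i))))"
    using w unfolding piecewise_continuous_def by blast
  \<comment> \<open>The partition for \<open>w\<close> is shifted by \<tau>, so that its last point
    \<open>\<xi> k = 0\<close> lands on \<tau>. One further interval, from \<tau> to \<theta>,
    covers the constant part.\<close>
  define \<eta> where "\<eta> i = (if i \<le> k then \<tau> + \<xi> i else \<theta>)" for i
  \<comment> \<open>This keeps all partition points in \<open>[-h, 0]\<close>, which decides the
    branch of \<open>kappa\<close> on each interval.\<close>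
  have up: "\<xi> i \<le> \<xi> j" if "i \<le> j" "j \<le> k" for i j
    using that
  proof (induction j rule: dec_induct)
    case (step n)
    then show ?case using pc[of n] by simp
  qed simp
  have main: "\<eta> i < \<eta> (Suc i) \<and> continuous_on {\<eta> i..<\<eta> (Suc i)} (kappa \<theta> h \<tau> z w) \<and>
      (\<exists>l. (kappa \<theta> h \<tau> z w \<longlongrightarrow> l) (at_left (\<eta> (Suc i))))" if "i < Suc k" for i
  proof (cases "i < k")
    case True
    have lt: "\<xi> i < \<xi> (Suc i)" using pc[OF True] by blast
    have bd: "- h \<le> \<xi> i" "\<xi> (Suc i) \<le> 0" using up[of 0 i] up[of "Suc i" k] \<xi> True by auto
    have eq: "kappa \<theta> h \<tau> z w t = w (t - \<tau>)" if "t \<in> {\<eta> i..<\<eta> (Suc i)}" for t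
      using that True bd \<open>\<tau> < \<theta>\<close> unfolding kappa_def \<eta>_def by auto
    have "continuous_on {\<eta> i..<\<eta> (Suc i)} (\<lambda>t. w (t - \<tau>))"
    proof (rule continuous_on_compose2[where g=w and f="\<lambda>t. t - \<tau>"])
      show "continuous_on {\<xi> i..<\<xi> (Suc i)} w" using pc[OF True] by blast
      show "(\<lambda>t. t - \<tau>) ` {\<eta> i..<\<eta> (Suc i)} \<subseteq> {\<xi> i..<\<xi> (Suc i)}"
        using True by (auto simp: \<eta>_def)
    qed (intro continuous_intros)
    then have cont: "continuous_on {\<eta> i..<\<eta> (Suc i)} (kappa \<theta> h \<tau> z w)"
      by (rule continuous_on_eq) (simp add: eq)
    obtain l where "(w \<longlongrightarrow> l) (at_left (\<xi> (Suc i)))" using pc[OF True] by blast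
    \<comment> \<open>Plain convergence of the shift would not suffice: \<open>w\<close> has only a
      left limit there, so the shift must also stay on the left side.\<close>
    moreover have "filterlim (\<lambda>t. t - \<tau>) (at_left (\<xi> (Suc i))) (at_left (\<eta> (Suc i)))"
      using True unfolding \<eta>_def filterlim_at
      by (auto simp: eventually_at_filter intro!: tendsto_eq_intros)
    ultimately have "((\<lambda>t. w (t - \<tau>)) \<longlongrightarrow> l) (at_left (\<eta> (Suc i)))"
      using filterlim_compose by blast
    moreover have "\<forall>\<^sub>F t in at_left (\<eta> (Suc i)). w (t - \<tau>) = kappa \<theta> h \<tau> z w t"
      unfolding eventually_at_left_field using eq lt True
      by (intro exI[of _ "\<eta> i"]) (auto simp: \<eta>_def)
    ultimately have "(kappa \<theta> h \<tau> z w \<longlongrightarrow> l) (at_left (\<eta> (Suc i)))"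
      by (rule Lim_transform_eventually)
    moreover have "\<eta> i < \<eta> (Suc i)" using lt True by (simp add: \<eta>_def)
    ultimately show ?thesis using cont by blast
  next
    case False
    then have [simp]: "i = k" using that by simp
    have eq: "kappa \<theta> h \<tau> z w t = z" if "t \<in> {\<tau>..<\<theta>}" for t
      using that up[of 0 k] \<xi> unfolding kappa_def by auto
    have "continuous_on {\<tau>..<\<theta>} (kappa \<theta> h \<tau> z w)"
      using continuous_on_const[of "{\<tau>..<\<theta>}" z] by (rule continuous_on_eq) (simp add: eq)
    moreover have "\<forall>\<^sub>F t in at_left \<theta>. kappa \<theta> h \<tau> z w t = z"
      unfolding eventually_at_left_field using eq \<open>\<tau> < \<theta>\<close>
      by (intro exI[of _ \<tau>]) auto
    then have "(kappa \<theta> h \<tau> z w \<longlongrightarrow> z) (at_left \<theta>)" by (rule tendsto_eventually)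
    ultimately show ?thesis using \<open>\<tau> < \<theta>\<close> \<xi> by (auto simp: \<eta>_def)
  qed
  show ?thesis unfolding piecewise_continuous_def
    by (intro exI[of _ "Suc k"] exI[of _ \<eta>]) (use main \<xi> in \<open>auto simp: \<eta>_def\<close>)
qed

lemma kappa_in_Lambda:
  assumes "w \<in> PC h" "h > 0" "\<tau> < \<theta>"
  shows "kappa \<theta> h \<tau> z w \<in> Lambda \<theta> h \<tau> z w"
proof -
  have "0-lipschitz_on {\<tau>..\<theta>} (kappa \<theta> h \<tau> z w)"
    using \<open>h > 0\<close> by (intro lipschitz_onI) (auto simp: kappa_def)
  moreover have "kappa \<theta> h \<tau> z w \<in> extensional {\<tau> - h..\<theta>}" by (simp add: kappa_def)
  ultimately show ?thesis
    using assms piecewise_continuous_kappa[of h w \<tau> \<theta> z]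
    unfolding Lambda_def PC_Icc_def PC_def PC_Ico_def by (auto simp: kappa_def)
qed

section \<open>Computation of the sub- and superdifferential\<close>

text \<open>For the pair \<open>(d, g)\<close> the quotient is exactly the remainder along
  \<open>kappa\<close> divided by its scale. What is left is to fit a box \<open>O_plus\<close> into
  a ball of the product metric.\<close>

lemma has_ci_derivative_diff_quotient:
  assumes "w \<in> PC h" "h > 0" "\<tau> < \<theta>" "has_ci_derivative \<theta> h \<phi> \<tau> z w d g" "e > 0"
  shows "\<exists>\<delta>>0. \<forall>(t, x)\<in>O_plus \<theta> \<tau> z \<delta> - {(\<tau>, z)}. \<bar>diff_quotient \<theta> h \<phi> \<tau> z w d g t x\<bar> \<le> e"
proof -
  let ?n = "\<lambda>t x. \<phi> t x (segment h (kappa \<theta> h \<tau> z w) t) - \<phi> \<tau> z w - ((t - \<tau>) * d + inner (x - z) g)"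
  have "(\<lambda>(t, x). ?n t x) \<in> o[at (\<tau>, z) within {\<tau>..\<theta>} \<times> UNIV](\<lambda>(t, x). \<bar>t - \<tau>\<bar> + norm (x - z))"
    using assms(4) kappa_in_Lambda[OF assms(1-3)] unfolding has_ci_derivative_def by blast
  from landau_o.smallD[OF this \<open>e > 0\<close>] obtain b where b: "b > 0"
    "\<And>t x. t \<in> {\<tau>..\<theta>} \<Longrightarrow> (t, x) \<noteq> (\<tau>, z) \<Longrightarrow> dist (t, x) (\<tau>, z) < b \<Longrightarrow>
       \<bar>?n t x\<bar> \<le> e * (\<bar>t - \<tau>\<bar> + norm (x - z))"
    unfolding eventually_at by (auto simp: case_prod_unfold)
  \<comment> \<open>In the box of size \<open>b / 3\<close> the distance to
    \<open>(\<tau>, z)\<close> is at most \<open>2 * b / 3\<close>, strictly below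
    \<open>b\<close>.\<close>
  have "\<bar>diff_quotient \<theta> h \<phi> \<tau> z w d g t x\<bar> \<le> e"
    if v: "(t, x) \<in> O_plus \<theta> \<tau> z (b / 3) - {(\<tau>, z)}" for t x
  proof -
    have t: "t \<in> {\<tau>..\<theta>}" "t - \<tau> \<le> b / 3" "norm (x - z) \<le> b / 3" "(t, x) \<noteq> (\<tau>, z)"
      using v unfolding O_plus_def by auto
    have "dist (t, x) (\<tau>, z) \<le> dist t \<tau> + dist x z"
      unfolding dist_Pair_Pair by (rule sqrt_sum_squares_le_sum) auto
    then have "dist (t, x) (\<tau>, z) < b" using t b(1) by (simp add: dist_norm)
    then have "\<bar>?n t x\<bar> \<le> e * (\<bar>t - \<tau>\<bar> + norm (x - z))" using b(2) t by blast
    moreover have "\<bar>t - \<tau>\<bar> + norm (x - z) > 0"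
      using t(4) by (cases "t = \<tau>") (auto intro: add_pos_nonneg)
    ultimately show ?thesis
      unfolding diff_quotient_def abs_divide by (simp add: field_simps)
  qed
  then show ?thesis using b(1) by (intro exI[of _ "b / 3"]) auto
qed

text \<open>This confines \<phi> to the quotient for \<open>(d, g)\<close>, which is small near
  \<open>(\<tau>, z)\<close>, and leaves an explicit term. Division by zero yields zero, so the
  identity survives at \<open>(\<tau>, z)\<close> itself.\<close>

lemma diff_quotient_change:
  "diff_quotient \<theta> h \<phi> \<tau> z w p0 p t x = diff_quotient \<theta> h \<phi> \<tau> z w d g t x +
     ((t - \<tau>) * (d - p0) + inner (x - z) (g - p)) / (\<bar>t - \<tau>\<bar> + norm (x - z))"
  unfolding diff_quotient_def add_divide_distrib[symmetric] by (simp add: algebra_simps)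

lemma D_minus_eq:
  assumes "w \<in> PC h" "h > 0" "\<tau> < \<theta>" "has_ci_derivative \<theta> h \<phi> \<tau> z w d g"
  shows "D_minus \<theta> h \<phi> \<tau> z w = {(p0, p). p0 \<le> d \<and> p = g}"
proof -
  have "(p0, p) \<in> D_minus \<theta> h \<phi> \<tau> z w \<longleftrightarrow> p0 \<le> d \<and> p = g" for p0 p
  proof
    assume "p0 \<le> d \<and> p = g"
    then have p: "p0 \<le> d" "p = g" by auto
    show "(p0, p) \<in> D_minus \<theta> h \<phi> \<tau> z w"
      unfolding mem_D_minus_iff
    proof (intro allI impI)
      fix e :: real assume "e > 0"
      from has_ci_derivative_diff_quotient[OF assms this] obtain b where b: "b > 0"
        "\<And>t x. (t, x) \<in> O_plus \<theta> \<tau> z b - {(\<tau>, z)} \<Longrightarrow> \<bar>diff_quotient \<theta> h \<phi> \<tau> z w d g t x\<bar> \<le> e"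
        by blast
      have "diff_quotient \<theta> h \<phi> \<tau> z w p0 p t x \<ge> - e" if "(t, x) \<in> O_plus \<theta> \<tau> z b - {(\<tau>, z)}" for t x
      proof -
        \<comment> \<open>With \<open>p = g\<close> this is the whole explicit term; its sign rests
          on time moving only forward in \<open>O_plus\<close>.\<close>
        have "(t - \<tau>) * (d - p0) / (\<bar>t - \<tau>\<bar> + norm (x - z)) \<ge> 0"
          using that p unfolding O_plus_def by auto
        then show ?thesis
          using b(2)[OF that] p diff_quotient_change[of \<theta> h \<phi> \<tau> z w p0 p t x d g] by simp
      qed
      then show "\<exists>\<delta>>0. \<forall>(t, x)\<in>O_plus \<theta> \<tau> z \<delta> - {(\<tau>, z)}. - e \<le> diff_quotient \<theta> h \<phi> \<tau> z w p0 p t x"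
        using b(1) by blast
    qed
  next
    assume D: "(p0, p) \<in> D_minus \<theta> h \<phi> \<tau> z w"
    \<comment> \<open>The tolerance \<open>e\<close> is split evenly between the derivative and
      membership in \<open>D_minus\<close>, so the explicit term is at least \<open>- e\<close>. Two
      test points then give the two bounds.\<close>
    have bounds: "p0 \<le> d + e \<and> norm (g - p) \<le> e" if "e > 0" for e
    proof -
      have "e / 2 > 0" using that by simp
      from has_ci_derivative_diff_quotient[OF assms this] obtain b where b: "b > 0"
        "\<And>t x. (t, x) \<in> O_plus \<theta> \<tau> z b - {(\<tau>, z)} \<Longrightarrow> \<bar>diff_quotient \<theta> h \<phi> \<tau> z w d g t x\<bar> \<le> e / 2"
        by blast
      from D \<open>e / 2 > 0\<close> obtain c where c: "c > 0"
        "\<And>t x. (t, x) \<in> O_plus \<theta> \<tau> z c - {(\<tau>, z)} \<Longrightarrow> diff_quotient \<theta> h \<phi> \<tau> z w p0 p t x \<ge> - (e / 2)"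
        unfolding mem_D_minus_iff by blast
      \<comment> \<open>The cap \<open>\<theta> - \<tau>\<close> keeps the time test point
        \<open>\<tau> + s\<close> within the horizon.\<close>
      define s where "s = min (min b c) (\<theta> - \<tau>)"
      have s: "s > 0" "s \<le> b" "s \<le> c" "\<tau> + s \<le> \<theta>" using b(1) c(1) \<open>\<tau> < \<theta>\<close> by (auto simp: s_def)
      have quot: "((t - \<tau>) * (d - p0) + inner (x - z) (g - p)) / (\<bar>t - \<tau>\<bar> + norm (x - z)) \<ge> - e"
        if "(t, x) \<in> O_plus \<theta> \<tau> z s - {(\<tau>, z)}" for t x
      proof -
        have "(t, x) \<in> O_plus \<theta> \<tau> z b - {(\<tau>, z)}" "(t, x) \<in> O_plus \<theta> \<tau> z c - {(\<tau>, z)}"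
          using that s unfolding O_plus_def by auto
        from b(2)[OF this(1)] c(2)[OF this(2)]
        show ?thesis using diff_quotient_change[of \<theta> h \<phi> \<tau> z w p0 p t x d g] by linarith
      qed
      \<comment> \<open>Moving in time alone, the explicit term equals
        \<open>d - p0\<close>.\<close>
      have "p0 \<le> d + e"
        using quot[of "\<tau> + s" z] s unfolding O_plus_def by simp
      moreover have "norm (g - p) \<le> e"
      proof (cases "g = p")
        case False
        \<comment> \<open>A step of length \<open>s\<close> against this unit vector, at time
          \<tau>, makes the explicit term equal to \<open>- norm (g - p)\<close>.\<close>
        define u where "u = (g - p) /\<^sub>R norm (g - p)"
        have "norm u = 1" using False by (simp add: u_def)
        have "inner u (g - p) = norm (g - p)"
          using False by (simp add: u_def dot_square_norm power2_eq_square)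
        moreover have "(\<tau>, z - s *\<^sub>R u) \<in> O_plus \<theta> \<tau> z s - {(\<tau>, z)}"
          using s \<open>norm u = 1\<close> \<open>\<tau> < \<theta>\<close> unfolding O_plus_def by auto
        ultimately show ?thesis using quot[of \<tau> "z - s *\<^sub>R u"] s \<open>norm u = 1\<close> by simp
      qed (use that in simp)
      ultimately show ?thesis ..
    qed
    have "p0 \<le> d" by (rule field_le_epsilon) (simp only: bounds)
    moreover have "norm (g - p) \<le> 0"
      by (rule field_le_epsilon) (simp only: bounds add_0)
    ultimately show "p0 \<le> d \<and> p = g" by simp
  qed
  then show ?thesis by auto
qed

text \<open>\<open>D_minus\<close> is defined without reference to a derivative, so two derivatives
  describe the same set. The extreme point of each description lies in the other, which forces
  equality.\<close>

lemma has_ci_derivative_unique: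
  assumes "w \<in> PC h" "h > 0" "\<tau> < \<theta>"
    and "has_ci_derivative \<theta> h \<phi> \<tau> z w d g" "has_ci_derivative \<theta> h \<phi> \<tau> z w d' g'"
  shows "d = d' \<and> g = g'"
proof -
  have "{(p0, p). p0 \<le> d \<and> p = g} = {(p0, p). p0 \<le> d' \<and> p = g'}"
    using D_minus_eq[OF assms(1-3)] assms(4,5) by metis
  then have "(d, g) \<in> {(p0, p). p0 \<le> d' \<and> p = g'}" "(d', g') \<in> {(p0, p). p0 \<le> d \<and> p = g}"
    by auto
  then show ?thesis by auto
qed

lemma D_plus_eq:
  assumes "w \<in> PC h" "h > 0" "\<tau> < \<theta>" "has_ci_derivative \<theta> h \<phi> \<tau> z w d g"
  shows "D_plus \<theta> h \<phi> \<tau> z w = {(q0, q). q0 \<ge> d \<and> q = g}"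
proof -
  have "(q0, q) \<in> D_plus \<theta> h \<phi> \<tau> z w \<longleftrightarrow> q0 \<ge> d \<and> q = g" for q0 q
    unfolding mem_D_plus_iff D_minus_eq[OF assms(1-3) has_ci_derivative_uminus[OF assms(4)]] by auto
  then show ?thesis by auto
qed

theorem proposition2p18:
  fixes t0 \<theta> h \<tau> :: real
    and z :: "real ^ 'n"
    and w :: "real \<Rightarrow> real ^ 'n"
    and \<phi> :: "real \<Rightarrow> real ^ 'n \<Rightarrow> (real \<Rightarrow> real ^ 'n) \<Rightarrow> real"
  assumes "t0 < \<theta>" and "h > 0"
    and "\<phi> \<in> Phi t0 \<theta> h"
    and "(\<tau>, z, w) \<in> GG t0 \<theta> h" and "\<tau> < \<theta>"
    and "ci_differentiable \<theta> h \<phi> \<tau> z w"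
  shows "D_minus \<theta> h \<phi> \<tau> z w =
           {(p0, p). p0 \<le> ci_deriv \<theta> h \<phi> \<tau> z w \<and> p = ci_grad \<theta> h \<phi> \<tau> z w} \<and>
         D_plus \<theta> h \<phi> \<tau> z w =
           {(q0, q). q0 \<ge> ci_deriv \<theta> h \<phi> \<tau> z w \<and> q = ci_grad \<theta> h \<phi> \<tau> z w}"
proof -
  from assms(6) obtain d g where dg: "has_ci_derivative \<theta> h \<phi> \<tau> z w d g"
    unfolding ci_differentiable_def by blast
  have w: "w \<in> PC h" using assms(4) by (simp add: GG_def)
  note unique = has_ci_derivative_unique[OF w \<open>h > 0\<close> \<open>\<tau> < \<theta>\<close> _ dg]
  \<comment> \<open>Both are definite descriptions, so they take these values only thanks to
    uniqueness.\<close>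
  have "ci_deriv \<theta> h \<phi> \<tau> z w = d" "ci_grad \<theta> h \<phi> \<tau> z w = g"
    unfolding ci_deriv_def ci_grad_def by (rule the_equality; use dg unique in blast)+
  then show ?thesis
    using D_minus_eq[OF w \<open>h > 0\<close> \<open>\<tau> < \<theta>\<close> dg] D_plus_eq[OF w \<open>h > 0\<close> \<open>\<tau> < \<theta>\<close> dg] by simp
qed

end
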